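(* A preference relation $\succ$ on $\Delta$ can be represented by an SSB function if and only if it satisfies continuity, convexity, and symmetry.
   Context: $\mathcal U$ is a non-empty finite set and $\Delta$ is the set of all probability measures on $\mathcal U$, with the Euclidean topology inherited from $\mathbb R^{\mathcal U}$. For $p,q\in\Delta$ and $\lambda\in[0,1]$, $p\lambda q=\lambda p+(1-\lambda)q$. A preference relation is an asymmetric binary relation $\succ$ on $\Delta$; $p\sim q$ means neither $p\succ q$ nor $q\succ p$. Let $U(p)=\{q\in\Delta: q\succ p\}$, $L(p)=\{q\in\Delta: p\succ q\}$, $I(p)=\{q\in\Delta: p\sim q\}$. Continuity: for all $p\in\Delta$, $U(p)$ and $L(p)$ are open in $\Delta$. Convexity: for all $p\in\Delta$, $U(p)$, $L(p)$, $U(p)\cup I(p)$ and $L(p)\cup I(p)$ are convex. Symmetry: for all $p,q,r\in\Delta$ and $\lambda\in(0,1)$, if $q\sim\frac12p+\frac12r$ and $p\lambda r\sim\frac12p+\frac12q$, then $r\lambda p\sim\frac12r+\frac12q$. An SSB (skew-symmetric bilinear) function is a map $\phi\colon\Delta\times\Delta\to\mathbb R$ with $\phi(p,q)=-\phi(q,p)$ for all $p,q\in\Delta$ that is linear (i.e. preserves convex combinations) in each argument. It represents $\succ$ if for all $p,q\in\Delta$: $p\succ q$ if and only if $\phi(p,q)>0$. *)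

theory Defs
  imports "HOL-Analysis.Analysis"
begin

text \<open>
  The finite non-empty set of alternatives is the universe of a type of class \<open>finite\<close>. A probability
  measure on it is identified with its vector of point masses, so that \<open>\<Delta>\<close> carries the subspace
  topology of the Euclidean space \<open>real^'u\<close>.
\<close>

definition Delta :: "(real^'u::finite) set" where
  "Delta = {p. (\<forall>i. 0 \<le> p $ i) \<and> (\<Sum>i\<in>UNIV. p $ i) = 1}"

definition mix :: "real^'u::finite \<Rightarrow> real \<Rightarrow> real^'u \<Rightarrow> real^'u" where
  "mix p l q = l *\<^sub>R p + (1 - l) *\<^sub>R q"

text \<open>
  Relations and functions on \<open>\<Delta>\<close> are total on \<open>real^'u\<close>; every notion below depends only on
  their values on \<open>\<Delta>\<close>.
\<close>

definition preference_relation :: "(real^'u::finite \<Rightarrow> real^'u \<Rightarrow> bool) \<Rightarrow> bool" where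
  "preference_relation R \<longleftrightarrow> asymp_on Delta R"

definition indiff :: "(real^'u::finite \<Rightarrow> real^'u \<Rightarrow> bool) \<Rightarrow> real^'u \<Rightarrow> real^'u \<Rightarrow> bool" where
  "indiff R p q \<longleftrightarrow> \<not> R p q \<and> \<not> R q p"

definition upper_set :: "(real^'u::finite \<Rightarrow> real^'u \<Rightarrow> bool) \<Rightarrow> real^'u \<Rightarrow> (real^'u) set" where
  "upper_set R p = {q \<in> Delta. R q p}"

definition lower_set :: "(real^'u::finite \<Rightarrow> real^'u \<Rightarrow> bool) \<Rightarrow> real^'u \<Rightarrow> (real^'u) set" where
  "lower_set R p = {q \<in> Delta. R p q}"

definition indiff_set :: "(real^'u::finite \<Rightarrow> real^'u \<Rightarrow> bool) \<Rightarrow> real^'u \<Rightarrow> (real^'u) set" where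
  "indiff_set R p = {q \<in> Delta. indiff R p q}"

definition pref_continuity :: "(real^'u::finite \<Rightarrow> real^'u \<Rightarrow> bool) \<Rightarrow> bool" where
  "pref_continuity R \<longleftrightarrow>
     (\<forall>p\<in>Delta. openin (top_of_set Delta) (upper_set R p) \<and>
                openin (top_of_set Delta) (lower_set R p))"

definition pref_convexity :: "(real^'u::finite \<Rightarrow> real^'u \<Rightarrow> bool) \<Rightarrow> bool" where
  "pref_convexity R \<longleftrightarrow>
     (\<forall>p\<in>Delta. convex (upper_set R p) \<and> convex (lower_set R p) \<and>
                convex (upper_set R p \<union> indiff_set R p) \<and>
                convex (lower_set R p \<union> indiff_set R p))"

definition pref_symmetry :: "(real^'u::finite \<Rightarrow> real^'u \<Rightarrow> bool) \<Rightarrow> bool" where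
  "pref_symmetry R \<longleftrightarrow>
     (\<forall>p\<in>Delta. \<forall>q\<in>Delta. \<forall>r\<in>Delta. \<forall>l. 0 < l \<and> l < 1 \<longrightarrow>
        indiff R q (mix p (1/2) r) \<longrightarrow> indiff R (mix p l r) (mix p (1/2) q) \<longrightarrow>
        indiff R (mix r l p) (mix r (1/2) q))"

definition SSB :: "(real^'u::finite \<Rightarrow> real^'u \<Rightarrow> real) \<Rightarrow> bool" where
  "SSB \<phi> \<longleftrightarrow>
     (\<forall>p\<in>Delta. \<forall>q\<in>Delta. \<phi> p q = - \<phi> q p) \<and>
     (\<forall>p\<in>Delta. \<forall>q\<in>Delta. \<forall>r\<in>Delta. \<forall>l. 0 \<le> l \<and> l \<le> 1 \<longrightarrow>
        \<phi> (mix p l q) r = l * \<phi> p r + (1 - l) * \<phi> q r \<and>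
        \<phi> r (mix p l q) = l * \<phi> r p + (1 - l) * \<phi> r q)"

definition represents ::
    "(real^'u::finite \<Rightarrow> real^'u \<Rightarrow> real) \<Rightarrow> (real^'u \<Rightarrow> real^'u \<Rightarrow> bool) \<Rightarrow> bool" where
  "represents \<phi> R \<longleftrightarrow> (\<forall>p\<in>Delta. \<forall>q\<in>Delta. R p q \<longleftrightarrow> \<phi> p q > 0)"

end

theory Submission
  imports Defs
begin

text \<open>
  Symmetry and continuity make the preference on every segment either trivial or the linear order.
  Hence at a point \<open>x\<close> with full support the strict upper and lower sections are the two open sides of
  a hyperplane through \<open>x\<close>, with a normal \<open>f x\<close>, or both empty (\<open>f x = 0\<close>). The symmetry axiom says
  that, locally, the normal at a midpoint of \<open>m\<close> and \<open>n\<close> lies in the span of the normals at \<open>m\<close> and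
  \<open>n\<close>. Subdividing a segment finely and passing to the limit yields the Ceva-type relation
  \<open>f x y * f y z * f z x = - (f y x * f x z * f z y)\<close>, so the normals can be rescaled to a
  skew-symmetric family on an open dense set; skew-symmetry together with linearity in one argument
  gives bilinearity. Continuity and convexity carry the representation over to all of \<open>Delta\<close>.
\<close>

section \<open>Mixtures and the simplex\<close>

lemma convex_Delta: "convex (Delta :: (real^'u::finite) set)"
  by (rule convexI) (auto simp: Delta_def sum.distrib simp flip: sum_distrib_left)

lemma mix_in_Delta:
  assumes "p \<in> Delta" "q \<in> Delta" "0 \<le> l" "l \<le> 1"
  shows "mix p l q \<in> Delta"
  using assms by (auto simp: Delta_def mix_def sum.distrib simp flip: sum_distrib_left)

lemma inner_mix: "f \<bullet> mix p l q = l * (f \<bullet> p) + (1 - l) * (f \<bullet> q)"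
  by (simp add: mix_def inner_right_distrib)

lemma convex_mix: "convex S \<Longrightarrow> p \<in> S \<Longrightarrow> q \<in> S \<Longrightarrow> 0 \<le> l \<Longrightarrow> l \<le> 1 \<Longrightarrow> mix p l q \<in> S"
  unfolding mix_def by (rule convexD) auto

lemma mix_0 [simp]: "mix p 0 q = q" and mix_1 [simp]: "mix p 1 q = p" and mix_same [simp]: "mix p l p = p"
  by (simp_all add: mix_def flip: scaleR_left_distrib)

lemma mix_commute: "mix p l q = mix q (1 - l) p"
  by (simp add: mix_def)

lemma mix_mix_left: "mix (mix p k q) l q = mix p (k * l) q"
  by (simp add: mix_def vec_eq_iff algebra_simps)

lemma tendsto_mix: "((\<lambda>e. mix z e q) \<longlongrightarrow> q) (at_right 0)"
proof -
  have "((\<lambda>e. e *\<^sub>R z + (1 - e) *\<^sub>R q) \<longlongrightarrow> 0 *\<^sub>R z + (1 - 0) *\<^sub>R q) (at_right 0)"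
    by (intro tendsto_intros)
  then show ?thesis by (simp add: mix_def)
qed

lemma eventually_at_right_01: "\<forall>\<^sub>F e in at_right (0::real). 0 < e \<and> e < 1"
  using eventually_at_right_real[of 0 1] by simp

section \<open>Preference along a segment\<close>

locale convex_preference =
  fixes R :: "real^'u::finite \<Rightarrow> real^'u \<Rightarrow> bool"
  assumes pref: "preference_relation R"
    and continuity: "pref_continuity R"
    and convexity: "pref_convexity R"
    and symmetry: "pref_symmetry R"
begin

lemma asym: "p \<in> Delta \<Longrightarrow> q \<in> Delta \<Longrightarrow> R p q \<Longrightarrow> \<not> R q p"
  using pref by (auto simp: preference_relation_def asymp_on_def)

lemma irrefl: "p \<in> Delta \<Longrightarrow> \<not> R p p"
  using asym by blast

lemma upper_un_indiff: "p \<in> Delta \<Longrightarrow> upper_set R p \<union> indiff_set R p = {q \<in> Delta. \<not> R p q}"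
  and lower_un_indiff: "p \<in> Delta \<Longrightarrow> lower_set R p \<union> indiff_set R p = {q \<in> Delta. \<not> R q p}"
  using asym by (auto simp: upper_set_def lower_set_def indiff_set_def indiff_def)

lemma convex_sections:
  assumes "p \<in> Delta"
  shows "convex {q \<in> Delta. R q p}" "convex {q \<in> Delta. R p q}"
    "convex {q \<in> Delta. \<not> R q p}" "convex {q \<in> Delta. \<not> R p q}"
  using convexity assms upper_un_indiff[OF assms] lower_un_indiff[OF assms]
  by (auto simp: pref_convexity_def upper_set_def lower_set_def)

lemma mix_section:
  assumes "p \<in> Delta" "q \<in> Delta" "r \<in> Delta" "0 \<le> l" "l \<le> 1"
  shows "R q p \<Longrightarrow> R r p \<Longrightarrow> R (mix q l r) p" "R p q \<Longrightarrow> R p r \<Longrightarrow> R p (mix q l r)"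
    "\<not> R q p \<Longrightarrow> \<not> R r p \<Longrightarrow> \<not> R (mix q l r) p" "\<not> R p q \<Longrightarrow> \<not> R p r \<Longrightarrow> \<not> R p (mix q l r)"
    "indiff R p q \<Longrightarrow> indiff R p r \<Longrightarrow> indiff R p (mix q l r)"
  using convex_sections[OF assms(1), THEN convex_mix, of q r l] assms
  by (auto simp: indiff_def)

text \<open>Continuity enters the later arguments only in this form: a strict preference survives a
  small step of one of its members towards any \<open>z\<close>.\<close>

lemma eventually_mix:
  assumes "p \<in> Delta" "q \<in> Delta" "z \<in> Delta"
  shows "R q p \<Longrightarrow> \<forall>\<^sub>F e in at_right 0. R (mix z e q) p"
    and "R p q \<Longrightarrow> \<forall>\<^sub>F e in at_right 0. R p (mix z e q)"
proof -
  have D: "\<forall>\<^sub>F e in at_right 0. mix z e q \<in> Delta"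
    using eventually_at_right_01 by eventually_elim (use assms in \<open>auto intro: mix_in_Delta\<close>)
  have main: "\<forall>\<^sub>F e in at_right 0. mix z e q \<in> S" if S: "openin (top_of_set Delta) S" "q \<in> S" for S
  proof -
    obtain T where T: "open T" "S = Delta \<inter> T" using S(1) unfolding openin_open by blast
    with S have "\<forall>\<^sub>F e in at_right 0. mix z e q \<in> T"
      by (intro topological_tendstoD[OF tendsto_mix]) auto
    with D show ?thesis by eventually_elim (auto simp: T)
  qed
  show "R q p \<Longrightarrow> \<forall>\<^sub>F e in at_right 0. R (mix z e q) p"
    using main[of "upper_set R p"] continuity assms by (auto simp: pref_continuity_def upper_set_def elim: eventually_mono)
  show "R p q \<Longrightarrow> \<forall>\<^sub>F e in at_right 0. R p (mix z e q)"
    using main[of "lower_set R p"] continuity assms by (auto simp: pref_continuity_def lower_set_def elim: eventually_mono)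
qed

lemma symmetryD:
  assumes "p \<in> Delta" "q \<in> Delta" "r \<in> Delta" "0 < l" "l < 1"
    "indiff R q (mix p (1/2) r)" "indiff R (mix p l r) (mix p (1/2) q)"
  shows "indiff R (mix r l p) (mix r (1/2) q)"
  using symmetry assms unfolding pref_symmetry_def by blast

text \<open>Reversal swaps upper with lower sections and leaves indifference unchanged, so each
  result about better points has a dual about worse ones.\<close>

lemma converse: "convex_preference (\<lambda>p q. R q p)"
proof
  show "preference_relation (\<lambda>p q. R q p)"
    using pref by (auto simp: preference_relation_def asymp_on_def)
  show "pref_continuity (\<lambda>p q. R q p)"
    using continuity by (auto simp: pref_continuity_def upper_set_def lower_set_def)
  have I: "indiff (\<lambda>p q. R q p) = indiff R"
    by (auto simp: fun_eq_iff indiff_def)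
  show "pref_convexity (\<lambda>p q. R q p)"
    using convexity by (auto simp: pref_convexity_def upper_set_def lower_set_def indiff_set_def I)
  show "pref_symmetry (\<lambda>p q. R q p)"
    using symmetry unfolding pref_symmetry_def I .
qed

text \<open>
  If \<open>p\<close> were indifferent to the midpoint \<open>m\<close>, symmetry with \<open>q = p\<close> would turn the indifference of \<open>m\<close>
  to the points near \<open>p\<close> into an indifference of \<open>p\<close> to points near \<open>r\<close>, against continuity.
\<close>

lemma midpoint_above:
  assumes p: "p \<in> Delta" and r: "r \<in> Delta" and "R r p"
  shows "R (mix r (1/2) p) p"
proof (rule ccontr)
  define m where "m = mix r (1/2) p"
  have m: "m \<in> Delta" unfolding m_def using p r by (intro mix_in_Delta) auto
  assume "\<not> R (mix r (1/2) p) p"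
  moreover have "\<not> R p m"
    unfolding m_def using assms irrefl asym by (intro mix_section(4)) auto
  ultimately have pm: "indiff R p m" by (auto simp: indiff_def m_def)
  have "\<forall>\<^sub>F e in at_right 0. R (mix p e r) p"
    using assms by (intro eventually_mix)
  \<comment> \<open>The bound \<open>1/2\<close> makes \<open>2*e\<close> a valid weight: weight
    \<open>e\<close> towards \<open>r\<close> is weight \<open>2*e\<close> towards
    \<open>m\<close>.\<close>
  moreover have "\<forall>\<^sub>F e in at_right (0::real). 0 < e \<and> e < 1/2"
    using eventually_at_right_real[of 0 "1/2"] by simp
  ultimately have "\<forall>\<^sub>F e in at_right (0::real). R (mix p e r) p \<and> 0 < e \<and> e < 1/2"
    by eventually_elim auto
  then obtain e where e: "R (mix p e r) p" "0 < e" "e < 1/2"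
    using eventually_happens'[OF trivial_limit_at_right_real] by blast
  have "indiff R m (mix m (2*e) p)"
    using p m pm e irrefl by (intro mix_section(5)) (auto simp: indiff_def)
  then have "indiff R (mix m (2*e) p) m" by (auto simp: indiff_def)
  then have "indiff R (mix r e p) (mix r (1/2) p)" by (simp add: m_def mix_mix_left)
  moreover have "indiff R p (mix r (1/2) p)" using pm by (simp add: m_def)
  ultimately have "indiff R (mix p e r) (mix p (1/2) p)"
    using symmetryD[of r p p e] p r e by simp
  with e(1) show False unfolding indiff_def mix_same by blast
qed

text \<open>Repeated midpoints reach the weights \<open>(1/2)^k\<close>, arbitrarily close to
  \<open>p\<close>; convexity of the upper section of \<open>p\<close> fills in everything between
  such a point and \<open>r\<close>.\<close>

lemma mix_above:
  assumes p: "p \<in> Delta" and r: "r \<in> Delta" and rp: "R r p" and "0 < t" "t \<le> 1"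
  shows "R (mix r t p) p"
proof -
  have pow: "R (mix r ((1/2)^k) p) p" for k
  proof (induction k)
    case (Suc k)
    then have "R (mix (mix r ((1/2)^k) p) (1/2) p) p"
      using p r by (intro midpoint_above mix_in_Delta) (auto simp: power_le_one)
    then show ?case by (simp add: mix_mix_left mult.commute)
  qed (use rp in simp)
  obtain k where k: "(1/2)^k < t"
    using real_arch_pow_inv[of t "1/2"] assms by auto
  define s :: real where "s = (1/2)^k"
  have s: "0 < s" "s < t" using k by (auto simp: s_def)
  define l where "l = (t - s) / (1 - s)"
  have l: "0 \<le> l" "l \<le> 1" using s assms by (auto simp: l_def field_simps)
  have "l * (1 - s) = t - s" using s assms by (auto simp: l_def)
  then have "t = l + (1 - l) * s" by (simp add: algebra_simps)
  moreover have "mix r l (mix r s p) = mix r (l + (1 - l) * s) p"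
    by (simp add: mix_def vec_eq_iff algebra_simps)
  ultimately have "mix r t p = mix r l (mix r s p)" by simp
  also have "R \<dots> p"
    using p r rp l s assms pow[of k] by (intro mix_section(1)[OF _ _ mix_in_Delta]) (auto simp: s_def)
  finally show ?thesis .
qed

text \<open>\<open>mix_above\<close> puts the upper point \<open>x\<close> above \<open>p\<close>;
  the same lemma for the converse relation, based at \<open>x\<close>, puts the points from there
  down to \<open>p\<close> below \<open>x\<close>.\<close>

lemma segment_order:
  assumes p: "p \<in> Delta" and r: "r \<in> Delta" and rp: "R r p" and st: "0 \<le> s" "s < t" "t \<le> 1"
  shows "R (mix r t p) (mix r s p)"
proof -
  interpret conv: convex_preference "\<lambda>p q. R q p" by (rule converse)
  define x where "x = mix r t p"
  have x: "x \<in> Delta" "R x p"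
    unfolding x_def using assms by (auto intro: mix_in_Delta mix_above)
  have "R x (mix p (1 - s / t) x)"
    using p x st by (intro conv.mix_above) (auto simp: field_simps)
  also have "mix p (1 - s / t) x = mix r s p"
    using st by (simp add: mix_commute[of p] x_def mix_mix_left)
  finally show ?thesis by (simp add: x_def)
qed

end

section \<open>Interior points and their normals\<close>

text \<open>The relative interior of \<open>Delta\<close>: only at such points can every segment
  ending there be prolonged inside \<open>Delta\<close>.\<close>

definition Delta_pos :: "(real^'u::finite) set" where
  "Delta_pos = {p. (\<forall>i. 0 < p $ i) \<and> (\<Sum>i\<in>UNIV. p $ i) = 1}"

lemma Delta_pos_subset: "p \<in> Delta_pos \<Longrightarrow> p \<in> Delta"
  by (auto simp: Delta_pos_def Delta_def intro: less_imp_le)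

text \<open>Pairing with the all-ones vector \<open>1\<close> measures total mass, so the directions
  orthogonal to \<open>1\<close> are tangent to the simplex.\<close>

lemma one_inner_vec: "(1 :: real^'u::finite) \<bullet> y = (\<Sum>i\<in>UNIV. y $ i)"
  by (simp add: inner_vec_def)

lemma one_inner_Delta: "y \<in> Delta \<Longrightarrow> (1 :: real^'u::finite) \<bullet> y = 1"
  by (simp add: one_inner_vec Delta_def)

lemma axis_in_Delta: "axis i 1 \<in> Delta"
  by (auto simp: Delta_def axis_def)

lemma Delta_le_1: "y \<in> Delta \<Longrightarrow> y $ i \<le> 1"
  using member_le_sum[of i UNIV "\<lambda>i. y $ i"] by (auto simp: Delta_def)

text \<open>With \<open>e\<close> the smallest coordinate of \<open>x\<close>, the step
  \<open>e *\<^sub>R (x - y)\<close> past \<open>x\<close> keeps all coordinates nonnegative,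
  because \<open>e * y $ i \<le> e \<le> x $ i\<close>.\<close>

lemma reflect:
  assumes x: "x \<in> Delta_pos" and y: "y \<in> Delta"
  obtains l y' where "0 < l" "l < 1" "y' \<in> Delta" "x = mix y l y'"
proof -
  define e where "e = Min (range (($) x))"
  have e: "0 < e" "\<And>i. e \<le> x $ i"
    using x by (auto simp: e_def Delta_pos_def)
  define y' where "y' = x + e *\<^sub>R (x - y)"
  have "0 \<le> y' $ i" for i
  proof -
    have "e * y $ i \<le> e * 1" using e y Delta_le_1[OF y, of i] by (intro mult_left_mono) auto
    also have "\<dots> \<le> x $ i" using e by simp
    also have "\<dots> \<le> x $ i + e * x $ i" using e(1) x by (simp add: Delta_pos_def less_imp_le)
    finally show ?thesis by (simp add: y'_def algebra_simps)
  qed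
  then have "y' \<in> Delta"
    using x y by (auto simp: Delta_def Delta_pos_def y'_def sum.distrib sum_subtractf simp flip: sum_distrib_left)
  moreover have "x = mix y (e / (1 + e)) y'"
  proof -
    have "1 - e / (1 + e) = 1 / (1 + e)" using e(1) by (simp add: field_simps)
    then show ?thesis
      using e(1) by (simp add: mix_def y'_def vec_eq_iff divide_simps) (simp add: algebra_simps)
  qed
  ultimately show ?thesis using that[of "e / (1 + e)" y'] e(1) by auto
qed

context convex_preference
begin

text \<open>The end points are ranked strictly, either way, or indifferent. Each case fixes the rank
  of the inner point, and asymmetry turns the implications into equivalences.\<close>

lemma segment_iff:
  assumes y: "y \<in> Delta" "y' \<in> Delta" and l: "0 < l" "l < 1"
  shows "R y (mix y l y') \<longleftrightarrow> R y y'" "R (mix y l y') y' \<longleftrightarrow> R y y'"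
    "R (mix y l y') y \<longleftrightarrow> R y' y" "R y' (mix y l y') \<longleftrightarrow> R y' y"
proof -
  let ?x = "mix y l y'"
  have x: "?x \<in> Delta" using y l by (intro mix_in_Delta) auto
  have up: "R y ?x \<and> R ?x y'" if "R y y'"
    using segment_order[OF y(2) y(1) that, of l 1] segment_order[OF y(2) y(1) that, of 0 l] l by simp
  have down: "R y' ?x \<and> R ?x y" if "R y' y"
    using segment_order[OF y(1) y(2) that, of "1 - l" 1] segment_order[OF y(1) y(2) that, of 0 "1 - l"] l
    by (simp add: mix_commute[of y])
  have eq: "indiff R y ?x \<and> indiff R y' ?x" if "indiff R y y'"
    using that y l irrefl by (intro conjI mix_section(5)) (auto simp: indiff_def)
  show "R y ?x \<longleftrightarrow> R y y'" "R ?x y' \<longleftrightarrow> R y y'" "R ?x y \<longleftrightarrow> R y' y" "R y' ?x \<longleftrightarrow> R y' y"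
    using up down eq asym[OF y(1) x] asym[OF y(2) x] asym[OF x y(1)] asym[OF x y(2)]
    unfolding indiff_def by blast+
qed

text \<open>
  Separates the upper section at \<open>x\<close> from its complement. Both sets are first thickened in the
  direction \<open>1\<close>, since otherwise the separating functional could be constant on \<open>Delta\<close>.
\<close>

lemma ex_normal:
  assumes x: "x \<in> Delta_pos"
  shows "\<exists>f. f \<bullet> x = 0 \<and> (\<forall>y\<in>Delta. (R y x \<longleftrightarrow> f \<bullet> y > 0) \<and> (R x y \<longleftrightarrow> f \<bullet> y < 0))"
proof (cases "\<exists>u\<in>Delta. R u x")
  case False
  \<comment> \<open>A point below \<open>x\<close> would have its reflection in \<open>x\<close>
    above \<open>x\<close>.\<close>
  have "\<not> R x y" if "y \<in> Delta" for y
    using reflect[OF x that] segment_iff[OF that] False by metis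
  with False show ?thesis by (intro exI[of _ 0]) auto
next
  case True
  then obtain u where u: "u \<in> Delta" "R u x" by auto
  have xD: "x \<in> Delta" using x by (rule Delta_pos_subset)
  define A where "A = {y \<in> Delta. R y x}"
  define B where "B = {y \<in> Delta. \<not> R y x}"
  define T where "T C = (\<Union>y\<in>C. \<Union>z\<in>span {1}. {y + z})" for C :: "(real^'u) set"
  have conv: "convex (T C)" if "convex C" for C
    unfolding T_def by (rule convex_sums[OF that subspace_imp_convex[OF subspace_span]])
  have T_I: "y + s *\<^sub>R 1 \<in> T C" if "y \<in> C" for y s C
    using that unfolding T_def by (auto intro: span_scale span_base)
  have T_I0: "y \<in> T C" if "y \<in> C" for y C
    using T_I[OF that, of 0] by simp
  have T_E: "\<exists>y\<in>C. \<exists>s. w = y + s *\<^sub>R 1" if "w \<in> T C" for w C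
    using that by (auto simp: T_def span_singleton)
  have "T B \<inter> T A = {}"
  proof -
    have neq: "y + s *\<^sub>R 1 \<noteq> z + t *\<^sub>R 1" if yz: "y \<in> A" "z \<in> B" for y z s t
    proof
      assume eq: "y + s *\<^sub>R 1 = z + t *\<^sub>R 1"
      then have "1 \<bullet> (y + s *\<^sub>R 1) = 1 \<bullet> (z + t *\<^sub>R 1)" by simp
      then have "s * (1 \<bullet> (1::real^'u)) = t * (1 \<bullet> (1::real^'u))"
        using yz by (simp add: inner_add_right one_inner_Delta A_def B_def)
      then have "s = t" by simp
      with eq have "y = z" by simp
      with yz show False by (auto simp: A_def B_def)
    qed
    show ?thesis
    proof (intro equals0I, elim IntE)
      fix w assume "w \<in> T B" "w \<in> T A"
      then show False using T_E[of w A] T_E[of w B] neq by blast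
    qed
  qed
  moreover have "u \<in> T A" "x \<in> T B"
    using u xD irrefl T_I0[of u A] T_I0[of x B] by (auto simp: A_def B_def)
  moreover have "convex (T A)" "convex (T B)"
    unfolding A_def B_def using convex_sections[OF xD] conv by blast+
  ultimately obtain a b where ab: "a \<noteq> 0" "\<forall>y\<in>T B. a \<bullet> y \<le> b" "\<forall>y\<in>T A. b \<le> a \<bullet> y"
    using separating_hyperplane_sets[of "T B" "T A"] by blast
  \<comment> \<open>\<open>T A\<close> contains whole lines in direction \<open>1\<close>, on which
    \<open>a\<close> is bounded below; the multiple of \<open>1\<close> used here would bring the
    value down to \<open>b - 1\<close>.\<close>
  have a1: "a \<bullet> 1 = 0"
  proof (rule ccontr)
    assume "a \<bullet> 1 \<noteq> 0"
    moreover have "b \<le> a \<bullet> (u + ((b - a \<bullet> u - 1) / (a \<bullet> 1)) *\<^sub>R 1)"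
      using ab(3) T_I[of u A] u by (auto simp: A_def)
    ultimately show False by (simp add: inner_add_right)
  qed
  \<comment> \<open>On \<open>Delta\<close> the affine function \<open>a \<bullet> y - b\<close>
    becomes linear, since \<open>1 \<bullet> y = 1\<close> there.\<close>
  define f where "f = a - b *\<^sub>R 1"
  have f: "f \<bullet> y = a \<bullet> y - b" if "y \<in> Delta" for y
    using that by (simp add: f_def inner_diff_left one_inner_Delta)
  have fA: "f \<bullet> y \<ge> 0" if "y \<in> A" for y
    using ab(3) T_I0[OF that] that f by (auto simp: A_def)
  have fB: "f \<bullet> y \<le> 0" if "y \<in> B" for y
    using ab(2) T_I0[OF that] that f by (auto simp: B_def)
  have fx: "f \<bullet> x = 0"
  proof (rule antisym)
    show "f \<bullet> x \<le> 0" using fB[of x] xD irrefl by (auto simp: B_def)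
    have "\<forall>\<^sub>F e in at_right 0. 0 \<le> f \<bullet> mix u e x"
      using eventually_at_right_01
    proof eventually_elim
      case (elim e)
      then show ?case
        using u xD by (intro fA) (auto simp: A_def intro!: mix_in_Delta mix_above)
    qed
    then show "0 \<le> f \<bullet> x"
      by (intro tendsto_lowerbound[OF tendsto_inner[OF tendsto_const tendsto_mix]]) auto
  qed
  \<comment> \<open>Reflection in the interior point \<open>x\<close> reverses both the preference
    and the sign of \<open>f\<close>.\<close>
  have opp: "\<exists>y'\<in>Delta. (R y' x \<longleftrightarrow> R x y) \<and> (R x y' \<longleftrightarrow> R y x) \<and> (f \<bullet> y' < 0 \<longleftrightarrow> f \<bullet> y > 0) \<and> (f \<bullet> y' > 0 \<longleftrightarrow> f \<bullet> y < 0)"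
    if y: "y \<in> Delta" for y
  proof -
    obtain l y' where l: "0 < l" "l < 1" "y' \<in> Delta" "x = mix y l y'" using reflect[OF x y] .
    define c where "c = (1 - l) / l"
    have eq: "f \<bullet> y = - (c * (f \<bullet> y'))" "c > 0"
      using fx l by (auto simp: inner_mix field_simps c_def)
    have "f \<bullet> y' < 0 \<longleftrightarrow> f \<bullet> y > 0" "f \<bullet> y' > 0 \<longleftrightarrow> f \<bullet> y < 0"
      unfolding eq(1) using eq(2) by (auto simp: mult_less_0_iff zero_less_mult_iff)
    then show ?thesis using l segment_iff[OF y l(3,1,2)] by auto
  qed
  have "\<exists>z\<in>Delta. f \<bullet> z \<noteq> 0"
  proof (rule ccontr)
    assume "\<not> ?thesis"
    then have "f \<bullet> axis i 1 = 0" for i using axis_in_Delta by blast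
    then have "f = 0" by (simp add: vec_eq_iff inner_axis)
    then have "a = b *\<^sub>R 1" by (simp add: f_def)
    with a1 ab(1) show False by simp
  qed
  then obtain z where z: "z \<in> Delta" "f \<bullet> z < 0"
    using opp by (metis linorder_neqE_linordered_idom)
  \<comment> \<open>If \<open>f\<close> vanished at \<open>y\<close>, a small step towards
    \<open>z\<close> would stay above \<open>x\<close> by continuity and yet make \<open>f\<close>
    negative.\<close>
  have pos: "f \<bullet> y > 0" if y: "y \<in> Delta" "R y x" for y
  proof (rule ccontr)
    assume "\<not> f \<bullet> y > 0"
    then have 0: "f \<bullet> y = 0" using fA[of y] y by (auto simp: A_def)
    have "\<forall>\<^sub>F e in at_right 0. R (mix z e y) x \<and> 0 < e \<and> e < 1"
      using eventually_mix(1)[OF xD y(1) z(1) y(2)] eventually_at_right_01 by eventually_elim auto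
    then obtain e where e: "R (mix z e y) x" "0 < e" "e < 1"
      using eventually_happens'[OF trivial_limit_at_right_real] by blast
    then have "f \<bullet> mix z e y \<ge> 0"
      using y z by (intro fA) (auto simp: A_def intro: mix_in_Delta)
    moreover have "f \<bullet> mix z e y < 0" using e z 0 by (simp add: inner_mix mult_pos_neg)
    ultimately show False by simp
  qed
  have neg: "f \<bullet> y < 0" if y: "y \<in> Delta" "R x y" for y
    using opp[OF y(1)] pos y(2) by blast
  have zero: "f \<bullet> y = 0" if y: "y \<in> Delta" "\<not> R x y" "\<not> R y x" for y
    using opp[OF y(1)] fB y unfolding B_def by (metis (no_types, lifting) linorder_not_le mem_Collect_eq order_antisym_conv)
  show ?thesis
  proof (intro exI[of _ f] conjI ballI fx)
    fix y :: "real^'u" assume y: "y \<in> Delta"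
    show "R y x \<longleftrightarrow> f \<bullet> y > 0" "R x y \<longleftrightarrow> f \<bullet> y < 0"
      using pos[OF y] neg[OF y] zero[OF y] by force+
  qed
qed

text \<open>Controlled only at points of \<open>Delta_pos\<close>, and even there up to a positive
  factor, which is fixed when the bilinear form is built.\<close>

definition normal :: "real^'u \<Rightarrow> real^'u" where
  "normal x = (SOME f. f \<bullet> x = 0 \<and> (\<forall>y\<in>Delta. (R y x \<longleftrightarrow> f \<bullet> y > 0) \<and> (R x y \<longleftrightarrow> f \<bullet> y < 0)))"

lemma normal:
  assumes "x \<in> Delta_pos"
  shows "normal x \<bullet> x = 0"
    and "y \<in> Delta \<Longrightarrow> R y x \<longleftrightarrow> normal x \<bullet> y > 0"
    and "y \<in> Delta \<Longrightarrow> R x y \<longleftrightarrow> normal x \<bullet> y < 0"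
  using someI_ex[OF ex_normal[OF assms]] by (simp_all flip: normal_def)

lemma indiff_normal: "x \<in> Delta_pos \<Longrightarrow> y \<in> Delta \<Longrightarrow> indiff R x y \<longleftrightarrow> normal x \<bullet> y = 0"
  by (auto simp: indiff_def normal)

text \<open>Both values record the one preference between \<open>x\<close> and \<open>y\<close>,
  read from either point: skew-symmetry at the level of signs.\<close>

lemma normal_swap:
  assumes "x \<in> Delta_pos" "y \<in> Delta_pos"
  shows "normal x \<bullet> y > 0 \<longleftrightarrow> normal y \<bullet> x < 0" "normal x \<bullet> y < 0 \<longleftrightarrow> normal y \<bullet> x > 0"
    "normal x \<bullet> y = 0 \<longleftrightarrow> normal y \<bullet> x = 0"
  using normal(2)[OF assms(1) Delta_pos_subset[OF assms(2)]] normal(3)[OF assms(1) Delta_pos_subset[OF assms(2)]]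
    normal(2)[OF assms(2) Delta_pos_subset[OF assms(1)]] normal(3)[OF assms(2) Delta_pos_subset[OF assms(1)]]
  by linarith+

end

section \<open>Normals along a segment and the cyclic relation\<close>

lemma convex_Delta_pos: "convex (Delta_pos :: (real^'u::finite) set)"
proof -
  have "(Delta_pos :: (real^'u) set) = (\<Inter>i. {p. axis i 1 \<bullet> p > 0}) \<inter> {p. 1 \<bullet> p = (1::real)}"
    by (auto simp: Delta_pos_def one_inner_vec inner_axis')
  then show ?thesis
    by (elim ssubst) (intro convex_Int convex_INT convex_halfspace_gt convex_hyperplane)
qed

lemma eventually_Delta_pos:
  assumes "x \<in> Delta_pos" "1 \<bullet> v = 0"
  shows "\<forall>\<^sub>F e in at_right 0. x + e *\<^sub>R v \<in> Delta_pos"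
proof -
  have "\<forall>\<^sub>F e in at_right 0. 0 < x $ i + e * v $ i" for i
  proof -
    have "((\<lambda>e. x $ i + e * v $ i) \<longlongrightarrow> x $ i + 0 * v $ i) (at_right 0)" by (intro tendsto_intros)
    then show ?thesis by (rule order_tendstoD) (use assms in \<open>simp add: Delta_pos_def\<close>)
  qed
  then have "\<forall>\<^sub>F e in at_right 0. \<forall>i. 0 < x $ i + e * v $ i" by (intro eventually_all_finite)
  then show ?thesis
    by eventually_elim
      (use assms in \<open>auto simp: Delta_pos_def one_inner_vec sum.distrib simp flip: sum_distrib_left\<close>)
qed

text \<open>The affine function with end values \<open>a\<close>, \<open>b\<close> changes sign at
  \<open>t\<close>. Grid points approach \<open>t\<close> from both sides, and there the function
  with end values \<open>c\<close>, \<open>d\<close> has the same sign. In the limit it vanishes at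
  \<open>t\<close> too, so the end values are proportional.\<close>

lemma affine_zero_transfer:
  fixes a b c d :: real
  assumes ab: "a * b < 0"
    and sgn: "\<forall>\<^sub>F N in sequentially. \<forall>i. 0 < i \<and> i < N \<longrightarrow>
      sgn ((1 - i / N) * a + (i / N) * b) = sgn ((1 - i / N) * c + (i / N) * d)"
  shows "b * c = a * d"
proof -
  define t where "t = a / (a - b)"
  define B where "B x = (1 - x) * a + x * b" for x
  define A where "A x = (1 - x) * c + x * d" for x
  have t: "0 < t" "t < 1" and ne: "a \<noteq> b"
    using ab by (auto simp: t_def mult_less_0_iff field_simps)
  have B: "B x = (x - t) * (b - a)" for x
    using ne by (simp add: B_def t_def field_simps)
  \<comment> \<open>\<open>j N / N\<close> is the last grid point not beyond \<open>t\<close>; the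
    next one lies strictly beyond it.\<close>
  define j where "j N = nat \<lfloor>t * real N\<rfloor>" for N
  have j: "j N \<le> t * N" "t * N < j N + 1" for N
    using t by (auto simp: j_def) linarith+
  have lim: "(\<lambda>N. j N / N) \<longlonglongrightarrow> t" "(\<lambda>N. Suc (j N) / N) \<longlonglongrightarrow> t"
  proof -
    have lo: "(\<lambda>N. t - 1 / real N) \<longlonglongrightarrow> t" and hi: "(\<lambda>N. t + 1 / real N) \<longlonglongrightarrow> t"
      using tendsto_diff[OF tendsto_const lim_1_over_n, of t] tendsto_add[OF tendsto_const lim_1_over_n, of t] by auto
    have bounds: "t - 1 / N \<le> j N / N \<and> j N / N \<le> t + 1 / N"
      "t - 1 / N \<le> Suc (j N) / N \<and> Suc (j N) / N \<le> t + 1 / N" if "N > 0" for N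
    proof -
      have eq: "t - 1 / N = (t * N - 1) / N" "t + 1 / N = (t * N + 1) / N"
        using that by (simp_all add: field_simps)
      show "t - 1 / N \<le> j N / N \<and> j N / N \<le> t + 1 / N"
        "t - 1 / N \<le> Suc (j N) / N \<and> Suc (j N) / N \<le> t + 1 / N"
        unfolding eq using j[of N] by (auto intro!: divide_right_mono)
    qed
    show "(\<lambda>N. j N / N) \<longlonglongrightarrow> t" "(\<lambda>N. Suc (j N) / N) \<longlonglongrightarrow> t"
      by (rule tendsto_sandwich[OF _ _ lo hi]; rule eventually_mono[OF eventually_gt_at_top[of 0]]; use bounds in blast)+
  qed
  have "filterlim (\<lambda>N. t * real N) at_top sequentially"
    by (rule filterlim_tendsto_pos_mult_at_top[OF tendsto_const t(1) filterlim_real_sequentially])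
  then have ev1: "\<forall>\<^sub>F N in sequentially. 1 < t * real N"
    by (simp add: filterlim_at_top_dense)
  have "filterlim (\<lambda>N. (1 - t) * real N) at_top sequentially"
    using t by (intro filterlim_tendsto_pos_mult_at_top[OF tendsto_const _ filterlim_real_sequentially]) auto
  then have ev2: "\<forall>\<^sub>F N in sequentially. 1 < (1 - t) * real N"
    by (simp add: filterlim_at_top_dense)
  have ev: "\<forall>\<^sub>F N in sequentially. 0 < j N \<and> Suc (j N) < N"
    using ev1 ev2
  proof eventually_elim
    case (elim N)
    have "0 < real (j N)" "real (Suc (j N)) < real N"
      using j[of N] elim by (auto simp: algebra_simps)
    then show ?case by linarith
  qed
  have sgn_A: "(x - t) * (A x * (b - a)) \<ge> 0" if "sgn (B x) = sgn (A x)" for x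
  proof -
    have "A x * B x \<ge> 0" using that by (auto simp: sgn_if zero_le_mult_iff split: if_splits)
    then show ?thesis by (simp add: B mult.left_commute)
  qed
  have cont: "(\<lambda>N. A (x N) * (b - a)) \<longlonglongrightarrow> A t * (b - a)" if "x \<longlonglongrightarrow> t" for x
    unfolding A_def by (intro tendsto_intros that)
  have up: "A t * (b - a) \<ge> 0"
  proof (rule tendsto_lowerbound[OF cont[OF lim(2)]])
    show "\<forall>\<^sub>F N in sequentially. 0 \<le> A (Suc (j N) / N) * (b - a)"
      using ev sgn
    proof eventually_elim
      case (elim N)
      then have "sgn (B (Suc (j N) / N)) = sgn (A (Suc (j N) / N))"
        unfolding A_def B_def by blast
      then have "0 \<le> (Suc (j N) / N - t) * (A (Suc (j N) / N) * (b - a))" by (rule sgn_A)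
      moreover have "Suc (j N) / N - t > 0" using j(2)[of N] elim by (simp add: field_simps)
      ultimately show ?case unfolding zero_le_mult_iff[of "Suc (j N) / N - t"] by linarith
    qed
  qed auto
  have down: "A t * (b - a) \<le> 0"
  proof (rule tendsto_upperbound[OF cont[OF lim(1)]])
    show "\<forall>\<^sub>F N in sequentially. A (j N / N) * (b - a) \<le> 0"
      using ev sgn
    proof eventually_elim
      case (elim N)
      then have s: "sgn (B (j N / N)) = sgn (A (j N / N))"
        unfolding A_def B_def by (metis Suc_lessD)
      have "j N / N - t \<le> 0" using j(1)[of N] elim by (simp add: field_simps)
      \<comment> \<open>The left neighbour may coincide with \<open>t\<close>; the shared sign is
        then zero.\<close>
      then consider "j N / N = t" | "j N / N - t < 0" by linarith
      then show ?case
      proof cases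
        case 1
        then have "A (j N / N) = 0" using s B[of t] by (simp add: sgn_0_0)
        then show ?thesis by simp
      next
        case 2
        then show ?thesis using sgn_A[OF s] unfolding zero_le_mult_iff[of "j N / N - t"] by linarith
      qed
    qed
  qed auto
  have "A t = 0" using up down ne by simp
  moreover have "A t = (a * d - b * c) / (a - b)"
  proof -
    have "1 - t = - b / (a - b)" using ne by (simp add: t_def field_simps)
    then show ?thesis by (simp add: A_def t_def diff_divide_distrib)
  qed
  ultimately show ?thesis using ne by simp
qed

context convex_preference
begin

lemma normal_nonzero_iff: "x \<in> Delta_pos \<Longrightarrow> y \<in> Delta \<Longrightarrow> normal x \<bullet> y \<noteq> 0 \<longleftrightarrow> R x y \<or> R y x"
  by (auto simp: normal)

text \<open>
  It suffices that \<open>g = normal m - (k / k') normal n\<close> vanishes at the points \<open>q\<close> close to \<open>c\<close> and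
  indifferent to it. This is the symmetry axiom for \<open>q\<close> and the reflections \<open>p = 2m - q\<close>, \<open>r = 2n - q\<close>,
  whose midpoint is the reflection of \<open>q\<close> in \<open>c\<close>. These reflections leave \<open>Delta\<close> unless \<open>m\<close> and \<open>n\<close>
  are close to each other, hence the assumptions \<open>ext\<close>.
\<close>

lemma normal_midpoint:
  assumes m: "m \<in> Delta_pos" and n: "n \<in> Delta_pos" and mn: "normal m \<bullet> n \<noteq> 0"
  defines "c \<equiv> mix m (1/2) n"
  assumes ext: "2 *\<^sub>R m - c \<in> Delta_pos" "2 *\<^sub>R n - c \<in> Delta_pos"
  shows "\<exists>a b. a \<noteq> 0 \<and> b \<noteq> 0 \<and> normal c = a *\<^sub>R normal m + b *\<^sub>R normal n"
proof -
  have mD: "m \<in> Delta" and nD: "n \<in> Delta" using m n by (auto dest: Delta_pos_subset)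
  have c: "c \<in> Delta_pos" unfolding c_def by (intro convex_mix[OF convex_Delta_pos] m n) auto
  have cD: "c \<in> Delta" using c by (rule Delta_pos_subset)
  define k where "k = normal m \<bullet> n"
  define k' where "k' = normal n \<bullet> m"
  define t where "t = normal c \<bullet> n"
  have k: "k \<noteq> 0" "k' \<noteq> 0" using mn normal_swap[OF m n] by (auto simp: k_def k'_def)
  \<comment> \<open>The coefficient makes \<open>g\<close> take opposite values at \<open>m\<close>
    and \<open>n\<close>, hence vanish at their midpoint \<open>c\<close>.\<close>
  define g where "g = normal m - (k / k') *\<^sub>R normal n"
  have gn: "g \<bullet> n = k" "g \<bullet> m = - k" using k m n normal(1)
    by (auto simp: g_def inner_diff_left simp flip: k_def k'_def)
  have gc: "g \<bullet> c = 0" by (simp add: c_def inner_mix gn)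
  have "R c n \<or> R n c"
    using mn normal_nonzero_iff[OF m nD] segment_iff[OF mD nD, of "1/2"] by (auto simp: c_def)
  then have t: "t \<noteq> 0" using normal_nonzero_iff[OF c nD] by (auto simp: t_def)
  have core: "g \<bullet> q = 0"
    if q: "q \<in> Delta_pos" "normal c \<bullet> q = 0" "2 *\<^sub>R c - q \<in> Delta_pos" "2 *\<^sub>R m - q \<in> Delta_pos" "2 *\<^sub>R n - q \<in> Delta_pos"
      and l: "0 < normal m \<bullet> q / (2 * k)" "normal m \<bullet> q / (2 * k) < 1" for q
  proof -
    define p where "p = 2 *\<^sub>R m - q"
    define r where "r = 2 *\<^sub>R n - q"
    define q' where "q' = 2 *\<^sub>R c - q"
    \<comment> \<open>The weight for which \<open>normal m\<close> vanishes at
      \<open>mix p l r\<close>, making this point indifferent to \<open>m\<close>.\<close>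
    define l where "l = 1 - normal m \<bullet> q / (2 * k)"
    have D: "q \<in> Delta" "p \<in> Delta" "r \<in> Delta" "q' \<in> Delta" using q by (auto simp: p_def q'_def r_def dest: Delta_pos_subset)
    have l01: "0 < l" "l < 1" using l by (auto simp: l_def)
    have eqs: "mix p (1/2) q = m" "mix r (1/2) q = n" "mix q (1/2) q' = c" "q' = mix p (1/2) r"
      by (simp_all add: mix_def p_def r_def q'_def c_def algebra_simps flip: scaleR_left_distrib)
    have "indiff R c q" using indiff_normal[OF c D(1)] q by simp
    then have "indiff R q q'" using segment_iff[OF D(1,4), of "1/2"] by (auto simp: eqs(3) indiff_def)
    moreover have "normal m \<bullet> mix p l r = 0"
      using k m normal(1) by (simp add: inner_mix p_def r_def inner_diff_right flip: k_def) (simp add: l_def field_simps)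
    then have "indiff R m (mix p l r)"
      using l01 D m by (subst indiff_normal) (auto intro!: mix_in_Delta)
    then have "indiff R (mix p l r) (mix p (1/2) q)" by (auto simp: eqs indiff_def)
    ultimately have "indiff R (mix r l p) (mix r (1/2) q)"
      using symmetryD[OF D(2,1,3) l01] by (simp add: eqs)
    then have "indiff R n (mix r l p)" by (auto simp: eqs indiff_def)
    then have "normal n \<bullet> mix r l p = 0"
      using l01 D n by (subst (asm) indiff_normal) (auto intro!: mix_in_Delta)
    moreover have "normal n \<bullet> mix r l p = (1 - l) * (2 * k') - normal n \<bullet> q"
      using n normal(1) by (simp add: inner_mix p_def r_def inner_diff_right flip: k'_def) (simp add: algebra_simps)
    ultimately have "normal n \<bullet> q = (1 - l) * (2 * k')" by simp
    then show ?thesis using k by (simp add: g_def inner_diff_left l_def)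
  qed
  have ker: "g \<bullet> v = 0" if v: "normal c \<bullet> v = 0" for v
  proof -
    \<comment> \<open>The tangential part of \<open>v\<close>; both functionals vanish at
      \<open>c\<close>, so subtracting a multiple of \<open>c\<close> does not change their
      values.\<close>
    define w where "w = v - (1 \<bullet> v) *\<^sub>R c"
    have w: "1 \<bullet> w = 0" "normal c \<bullet> w = 0" "g \<bullet> w = g \<bullet> v"
      using v gc normal(1)[OF c] one_inner_Delta[OF cD] by (auto simp: w_def inner_diff_right)
    have w': "1 \<bullet> (- w) = 0" using w by simp
    have cn: "2 *\<^sub>R c - c \<in> Delta_pos" using c by (simp add: scaleR_2)
    \<comment> \<open>At \<open>c\<close> the quotient is \<open>1/4\<close>, safely inside the open
      unit interval required by \<open>core\<close>.\<close>
    have "((\<lambda>e. normal m \<bullet> (c + e *\<^sub>R w) / (2 * k)) \<longlongrightarrow> normal m \<bullet> (c + 0 *\<^sub>R w) / (2 * k)) (at_right 0)"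
      using k by (intro tendsto_intros) auto
    moreover have "normal m \<bullet> (c + 0 *\<^sub>R w) / (2 * k) = 1/4"
      using k normal(1)[OF m] by (simp add: c_def inner_mix flip: k_def)
    ultimately have lim: "((\<lambda>e. normal m \<bullet> (c + e *\<^sub>R w) / (2 * k)) \<longlongrightarrow> 1/4) (at_right 0)" by simp
    have "\<forall>\<^sub>F e in at_right 0. g \<bullet> (c + e *\<^sub>R w) = 0 \<and> 0 < e"
      using order_tendstoD(1)[OF lim, of 0, simplified] order_tendstoD(2)[OF lim, of 1, simplified]
        eventually_Delta_pos[OF c w(1)] eventually_Delta_pos[OF cn w'] eventually_Delta_pos[OF ext(1) w']
        eventually_Delta_pos[OF ext(2) w'] eventually_at_right_01
    proof eventually_elim
      case (elim e)
      then show ?case using w normal(1)[OF c]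
        by (intro conjI core) (auto simp: inner_add_right algebra_simps)
    qed
    then obtain e where e: "g \<bullet> (c + e *\<^sub>R w) = 0" "0 < e"
      using eventually_happens'[OF trivial_limit_at_right_real] by blast
    then show ?thesis using gc w by (simp add: inner_add_right)
  qed
  \<comment> \<open>The kernel of \<open>normal c\<close> lies in that of \<open>g\<close>, so the
    two are proportional; their values at \<open>n\<close> give the factor.\<close>
  have "normal c \<bullet> w = ((t / k) *\<^sub>R g) \<bullet> w" for w
  proof -
    have "g \<bullet> (w - (normal c \<bullet> w / t) *\<^sub>R n) = 0"
      using t by (intro ker) (simp add: inner_diff_right flip: t_def)
    then show ?thesis using k t by (simp add: inner_diff_right gn field_simps)
  qed
  then have "normal c = (t / k) *\<^sub>R g" using vector_eq_rdot by blast
  then have "normal c = (t / k) *\<^sub>R normal m + (- t / k') *\<^sub>R normal n"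
    using k by (simp add: g_def algebra_simps)
  then show ?thesis using k t by (intro exI[of _ "t / k"] exI[of _ "- t / k'"]) auto
qed

text \<open>
  For large \<open>N\<close> consecutive division points are close enough for the midpoint lemma, so each normal
  is a combination of the preceding two.
\<close>

lemma normal_subdivision_span:
  fixes i N :: nat
  assumes m: "m \<in> Delta_pos" and n: "n \<in> Delta_pos" and mn: "normal m \<bullet> n \<noteq> 0"
    and ext: "mix n (- (1 / N)) m \<in> Delta_pos" "mix n (1 + 1 / N) m \<in> Delta_pos" and "i \<le> N"
  shows "normal (mix n (i / N) m) \<in> span {normal m, normal n}"
proof (cases "N = 0")
  case True
  then show ?thesis by (auto intro: span_base)
next
  case False
  then have N: "0 < N" by simp
  \<comment> \<open>Integer indices admit the points \<open>-1\<close> and \<open>N + 1\<close> just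
    outside the segment, needed as reflections at its ends.\<close>
  define X where "X j = mix n (real_of_int j / N) m" for j :: int
  have mD: "m \<in> Delta" and nD: "n \<in> Delta" using m n by (auto dest: Delta_pos_subset)
  have X: "X j \<in> Delta_pos" if "-1 \<le> j" "j \<le> int N + 1" for j
  proof -
    define l where "l = (real_of_int j + 1) / (N + 2)"
    have l: "0 \<le> l" "l \<le> 1" using that by (auto simp: l_def)
    have "l * (N + 2) = real_of_int j + 1" by (simp add: l_def)
    then have "real_of_int j = l * (N + 2) - 1" by simp
    then have "j / N = l * (1 + 1 / N) + (1 - l) * (- (1 / N))"
      using N by (simp only:) (simp add: field_simps)
    moreover have "mix (mix n a m) l (mix n b m) = mix n (l * a + (1 - l) * b) m" for a b
      by (simp add: mix_def vec_eq_iff algebra_simps)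
    ultimately have "X j = mix (mix n (1 + 1 / N) m) l (mix n (- (1 / N)) m)"
      unfolding X_def by metis
    also have "\<dots> \<in> Delta_pos" by (intro convex_mix[OF convex_Delta_pos] ext l)
    finally show ?thesis .
  qed
  have strict: "normal (X j) \<bullet> X k \<noteq> 0" if "0 \<le> j" "j < k" "k \<le> int N" for j k
  proof -
    have d: "0 \<le> j / N" "j / N < k / N" "k / N \<le> 1"
      using that N by (auto simp: divide_strict_right_mono)
    consider "R n m" | "R m n" using mn normal_nonzero_iff[OF m nD] by auto
    then have "R (X j) (X k) \<or> R (X k) (X j)"
    proof cases
      case 1
      then show ?thesis using segment_order[OF mD nD 1 d] by (simp add: X_def)
    next
      case 2
      then show ?thesis using segment_order[OF nD mD 2, of "1 - k / N" "1 - j / N"] d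
        by (simp add: X_def mix_commute[of n])
    qed
    then show ?thesis using normal_nonzero_iff[OF X Delta_pos_subset[OF X]] that by auto
  qed
  have X0: "X 0 = m" and XN: "X (int N) = n" using N by (simp_all add: X_def)
  let ?W = "span {normal (X 1), normal (X 0)}"
  have step: "normal (X (int i)) \<in> ?W \<and> normal (X (int i + 1)) \<in> ?W" if "i < N" for i
    using that
  proof (induction i)
    case 0
    then show ?case by (auto intro: span_base)
  next
    case (Suc i)
    define x where "x = X (int i)"
    define y where "y = X (int i + 2)"
    have mid: "mix x (1/2) y = X (int i + 1)"
      using N by (simp add: x_def y_def X_def mix_def vec_eq_iff field_simps flip: add_divide_distrib)
    have "2 *\<^sub>R x - X (int i + 1) = X (int i - 1)" "2 *\<^sub>R y - X (int i + 1) = X (int i + 3)"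
      using N by (simp_all add: x_def y_def X_def mix_def vec_eq_iff field_simps)
    then obtain a b where "a \<noteq> 0" "b \<noteq> 0" and ab: "normal (X (int i + 1)) = a *\<^sub>R normal x + b *\<^sub>R normal y"
      using normal_midpoint[of x y] strict[of "int i" "int i + 2"] X Suc.prems
      unfolding mid by (auto simp: x_def y_def)
    \<comment> \<open>As \<open>b\<close> is nonzero, the midpoint relation can be solved for the
      normal at the next point.\<close>
    then have "normal y = (1 / b) *\<^sub>R (normal (X (int i + 1)) - a *\<^sub>R normal x)"
      by simp
    also have "\<dots> \<in> ?W"
      using Suc by (intro span_scale span_diff) (auto simp: x_def)
    finally show ?case using Suc by (simp add: y_def add.commute)
  qed
  have W: "normal (X (int i)) \<in> ?W" if "i \<le> N" for i
    using step[of "i - 1"] step[of i] that N by (cases "i = N") (auto simp: of_nat_diff)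
  have "normal n \<in> ?W" using W[of N] XN by simp
  \<comment> \<open>Exchange argument: being no multiple of \<open>normal m\<close>,
    \<open>normal n\<close> can replace \<open>normal (X 1)\<close> as a generator.\<close>
  moreover have "normal n \<notin> span {normal (X 0)}"
  proof
    assume "normal n \<in> span {normal (X 0)}"
    then obtain c where "normal n = c *\<^sub>R normal m" by (auto simp: span_singleton X0)
    then have "normal n \<bullet> m = 0" using normal(1)[OF m] by simp
    then show False using mn normal_swap[OF m n] by simp
  qed
  ultimately have "normal (X 1) \<in> span {normal n, normal m}"
    using in_span_insert[of "normal n" "normal (X 1)" "{normal (X 0)}"] by (simp add: X0)
  then have "?W \<subseteq> span {normal m, normal n}"
    by (intro span_minimal) (auto simp: X0 insert_commute intro: span_base)
  then have "normal (X (int i)) \<in> span {normal m, normal n}" using W[OF \<open>i \<le> N\<close>] by blast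
  then show ?thesis by (simp add: X_def)
qed

text \<open>Vanishing at \<open>mix n t m\<close> itself fixes the ratio of the two coefficients,
  and the preference between that point and \<open>n\<close> fixes the overall sign. Up to a
  positive factor the value at \<open>u\<close> is then affine in \<open>t\<close>.\<close>

lemma sgn_normal_mix:
  assumes m: "m \<in> Delta_pos" and n: "n \<in> Delta_pos" and mn: "normal m \<bullet> n \<noteq> 0"
    and t: "0 < t" "t < 1"
    and sp: "normal (mix n t m) \<in> span {normal m, normal n}"
  shows "sgn (normal (mix n t m) \<bullet> u)
    = sgn ((1 - t) * (normal m \<bullet> u) + t * (- (normal m \<bullet> n) / (normal n \<bullet> m) * (normal n \<bullet> u)))"
proof -
  define z where "z = mix n t m"
  define k where "k = normal m \<bullet> n"
  define k' where "k' = normal n \<bullet> m"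
  have mD: "m \<in> Delta" and nD: "n \<in> Delta" using m n by (auto dest: Delta_pos_subset)
  have z: "z \<in> Delta_pos" unfolding z_def using t by (intro convex_mix[OF convex_Delta_pos] m n) auto
  have k: "k \<noteq> 0" "k' \<noteq> 0" using mn normal_swap[OF m n] by (auto simp: k_def k'_def)
  obtain a b where "normal z - a *\<^sub>R normal m \<in> span {normal n}" "normal z - a *\<^sub>R normal m = b *\<^sub>R normal n"
    using sp unfolding z_def by (auto simp: span_insert span_singleton)
  then have ab: "normal z = a *\<^sub>R normal m + b *\<^sub>R normal n" by (simp add: algebra_simps)
  define c where "c = a * k / (1 - t)"
  have zn: "normal z \<bullet> n = c * (1 - t)"
    using t n normal(1) by (simp add: ab inner_add_left c_def flip: k_def)
  have "0 = normal z \<bullet> mix n t m" using normal(1)[OF z] by (simp add: z_def)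
  also have "\<dots> = t * (c * (1 - t)) + (1 - t) * (b * k')"
    using m normal(1) by (simp add: inner_mix zn) (simp add: ab inner_add_left k'_def)
  also have "\<dots> = (1 - t) * (t * c + b * k')" by (simp add: algebra_simps)
  finally have "b * k' = - (t * c)" using t by simp
  then have b: "b = - (t * c) / k'" using k by (simp add: field_simps)
  have a: "a = c * (1 - t) / k" using t k by (simp add: c_def)
  have "normal z \<bullet> u = (c / k) * ((1 - t) * (normal m \<bullet> u) + t * (- k / k' * (normal n \<bullet> u)))"
    unfolding ab inner_add_left inner_scaleR_left a b using k by (simp add: field_simps)
  moreover have "sgn (c / k) = 1"
  proof -
    have "R n z \<longleftrightarrow> R n m" "R z n \<longleftrightarrow> R m n"
      using segment_iff[OF nD mD t] by (auto simp: z_def)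
    then have "c * (1 - t) > 0 \<longleftrightarrow> k > 0" "c * (1 - t) < 0 \<longleftrightarrow> k < 0"
      using normal(2,3)[OF z nD] normal(2,3)[OF m nD] by (auto simp: zn k_def)
    then have "c / k > 0" using k t by (auto simp: zero_less_mult_iff mult_less_0_iff zero_less_divide_iff)
    then show ?thesis by (rule sgn_pos)
  qed
  ultimately show ?thesis by (simp only: sgn_mult z_def k_def k'_def mult_1)
qed

text \<open>The preference between \<open>u\<close> and a division point can be read from the normal
  at that point or from \<open>normal u\<close>; up to positive factors both readings are affine
  along the segment. By \<open>opp\<close> they change sign, so \<open>affine_zero_transfer\<close>
  compares their end values.\<close>

lemma normal_cyclic_aux:
  assumes m: "m \<in> Delta_pos" and n: "n \<in> Delta_pos" and u: "u \<in> Delta_pos"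
    and mn: "normal m \<bullet> n \<noteq> 0" and opp: "(normal u \<bullet> m) * (normal u \<bullet> n) < 0"
  shows "(normal m \<bullet> n) * (normal n \<bullet> u) * (normal u \<bullet> m) = - ((normal n \<bullet> m) * (normal m \<bullet> u) * (normal u \<bullet> n))"
proof -
  define k where "k = normal m \<bullet> n"
  define k' where "k' = normal n \<bullet> m"
  define s where "s = - k / k'"
  have mD: "m \<in> Delta" and nD: "n \<in> Delta" and uD: "u \<in> Delta" using m n u by (auto dest: Delta_pos_subset)
  have k: "k \<noteq> 0" "k' \<noteq> 0" "s > 0"
    using mn normal_swap[OF m n] by (auto simp: k_def k'_def s_def divide_less_0_iff linorder_neq_iff)
  have swap: "sgn (normal z \<bullet> u) = - sgn (normal u \<bullet> z)" if "z \<in> Delta_pos" for z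
    using normal_swap[OF that u] by (auto simp: sgn_if)
  have "(normal m \<bullet> u) * (normal n \<bullet> u) < 0"
    using opp normal_swap[OF m u] normal_swap[OF n u] by (auto simp: mult_less_0_iff)
  then have neg: "(normal m \<bullet> u) * (s * (normal n \<bullet> u)) < 0"
    using k by (auto simp: mult_less_0_iff zero_less_mult_iff)
  have ext: "\<forall>\<^sub>F N in sequentially. x + (1 / real N) *\<^sub>R v \<in> Delta_pos" if "x \<in> Delta_pos" "1 \<bullet> v = 0" for x v :: "real^'u"
  proof -
    have "filterlim (\<lambda>N. 1 / real N) (at_right 0) sequentially"
      by real_asymp
    then show ?thesis
      using eventually_Delta_pos[OF that] by (rule filterlim_iff[THEN iffD1, rule_format])
  qed
  have "(s * (normal n \<bullet> u)) * (- (normal u \<bullet> m)) = (normal m \<bullet> u) * (- (normal u \<bullet> n))"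
  proof (rule affine_zero_transfer[OF neg])
    have "1 \<bullet> (m - n) = 0" "1 \<bullet> (n - m) = 0"
      using one_inner_Delta[OF mD] one_inner_Delta[OF nD] by (simp_all add: inner_diff_right)
    then have "\<forall>\<^sub>F N in sequentially. m + (1 / real N) *\<^sub>R (m - n) \<in> Delta_pos"
      "\<forall>\<^sub>F N in sequentially. n + (1 / real N) *\<^sub>R (n - m) \<in> Delta_pos"
      by (intro ext m n; simp)+
    then show "\<forall>\<^sub>F N in sequentially. \<forall>i. 0 < i \<and> i < N \<longrightarrow>
      sgn ((1 - real i / real N) * (normal m \<bullet> u) + real i / real N * (s * (normal n \<bullet> u)))
      = sgn ((1 - real i / real N) * - (normal u \<bullet> m) + real i / real N * - (normal u \<bullet> n))"
    proof eventually_elim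
      case (elim N)
      have eqs: "mix n (- (1 / N)) m = m + (1 / real N) *\<^sub>R (m - n)" "mix n (1 + 1 / N) m = n + (1 / real N) *\<^sub>R (n - m)"
        by (simp_all add: mix_def algebra_simps)
      show ?case
      proof (intro allI impI)
        fix i assume i: "0 < i \<and> i < N"
        define t where "t = real i / real N"
        have t: "0 < t" "t < 1" using i by (auto simp: t_def)
        have z: "mix n t m \<in> Delta_pos" using t by (intro convex_mix[OF convex_Delta_pos] m n) auto
        have "normal (mix n t m) \<in> span {normal m, normal n}"
          unfolding t_def using i elim by (intro normal_subdivision_span m n mn) (simp_all add: eqs)
        from sgn_normal_mix[OF m n mn t this, of u] swap[OF z]
        have "sgn ((1 - t) * (normal m \<bullet> u) + t * (s * (normal n \<bullet> u))) = sgn (- (normal u \<bullet> mix n t m))"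
          by (simp add: s_def k_def k'_def sgn_minus)
        also have "- (normal u \<bullet> mix n t m) = (1 - t) * - (normal u \<bullet> m) + t * - (normal u \<bullet> n)"
          by (simp add: inner_mix)
        finally show "sgn ((1 - real i / real N) * (normal m \<bullet> u) + real i / real N * (s * (normal n \<bullet> u)))
          = sgn ((1 - real i / real N) * - (normal u \<bullet> m) + real i / real N * - (normal u \<bullet> n))"
          unfolding t_def .
      qed
    qed
  qed
  then show ?thesis using k by (simp add: s_def field_simps flip: k_def k'_def)
qed

text \<open>
  The cocycle condition that allows the normals, each determined up to a positive factor only,
  to be rescaled to a skew-symmetric family.
\<close>

lemma normal_cyclic:
  assumes x: "x \<in> Delta_pos" and y: "y \<in> Delta_pos" and z: "z \<in> Delta_pos"
  shows "(normal x \<bullet> y) * (normal y \<bullet> z) * (normal z \<bullet> x) = - ((normal y \<bullet> x) * (normal x \<bullet> z) * (normal z \<bullet> y))"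
proof (cases "normal x \<bullet> y = 0 \<or> normal y \<bullet> z = 0 \<or> normal z \<bullet> x = 0")
  case True
  then show ?thesis using normal_swap(3)[OF x y] normal_swap(3)[OF y z] normal_swap(3)[OF z x] by auto
next
  case False
  then have nz: "normal x \<bullet> y \<noteq> 0" "normal y \<bullet> z \<noteq> 0" "normal z \<bullet> x \<noteq> 0" by auto
  \<comment> \<open>Of three pairwise strictly ranked points at most one beats both others and at
    most one loses to both, so some point has one of the others above it and one below.\<close>
  have "(normal x \<bullet> y) * (normal x \<bullet> z) < 0 \<or> (normal y \<bullet> z) * (normal y \<bullet> x) < 0 \<or> (normal z \<bullet> x) * (normal z \<bullet> y) < 0"
    using nz normal_swap(1,2)[OF x y] normal_swap(1,2)[OF y z] normal_swap(1,2)[OF z x]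
    unfolding mult_less_0_iff by linarith
  then consider "(normal x \<bullet> y) * (normal x \<bullet> z) < 0" | "(normal y \<bullet> z) * (normal y \<bullet> x) < 0" | "(normal z \<bullet> x) * (normal z \<bullet> y) < 0"
    by blast
  then show ?thesis
  proof cases
    case 1
    show ?thesis using normal_cyclic_aux[OF y z x nz(2) 1] by (simp add: mult_ac)
  next
    case 2
    show ?thesis using normal_cyclic_aux[OF z x y nz(3) 2] by (simp add: mult_ac)
  next
    case 3
    show ?thesis using normal_cyclic_aux[OF x y z nz(1) 3] by (simp add: mult_ac)
  qed
qed

section \<open>The bilinear form and its extension to the whole simplex\<close>

text \<open>
  A strict preference at which \<open>\<phi>\<close> vanishes would force both \<open>\<phi> m a > 0\<close> and \<open>\<phi> a m > 0\<close> for the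
  midpoint \<open>m\<close> of the pair; a positive value without strict preference contradicts the convexity of
  \<open>{y. \<not> R m y}\<close>.
\<close>

lemma representation_extends:
  assumes A: "A \<subseteq> Delta" "a \<in> A"
    and near: "\<And>a p. a \<in> A \<Longrightarrow> p \<in> Delta \<Longrightarrow> \<forall>\<^sub>F e in at_right 0. mix a e p \<in> A"
    and skew: "\<And>x y. \<phi> x y = - \<phi> y x"
    and lin: "\<And>x p l q. \<phi> x (mix p l q) = l * \<phi> x p + (1 - l) * \<phi> x q"
    and agree: "\<And>a y. a \<in> A \<Longrightarrow> y \<in> Delta \<Longrightarrow> R a y \<longleftrightarrow> \<phi> a y > 0"
      "\<And>a y. a \<in> A \<Longrightarrow> y \<in> Delta \<Longrightarrow> R y a \<longleftrightarrow> \<phi> y a > 0"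
    and p: "p \<in> Delta" and q: "q \<in> Delta"
  shows "R p q \<longleftrightarrow> \<phi> p q > 0"
proof -
  have aD: "a \<in> Delta" using A by auto
  have self: "\<phi> x x = 0" for x using skew[of x x] by linarith
  have lin': "\<phi> (mix x l y) z = l * \<phi> x z + (1 - l) * \<phi> y z" for x l y z
    using lin[of z x l y] skew[of z] skew[of _ z] by (metis minus_add_distrib mult_minus_right)
  have lim: "((\<lambda>e. \<phi> x (mix y e z)) \<longlongrightarrow> \<phi> x z) (at_right 0)" for x y z
  proof -
    have "((\<lambda>e. e * \<phi> x y + (1 - e) * \<phi> x z) \<longlongrightarrow> 0 * \<phi> x y + (1 - 0) * \<phi> x z) (at_right 0)"
      by (intro tendsto_intros)
    then show ?thesis by (simp add: lin)
  qed
  have lower: "\<forall>\<^sub>F e in at_right 0. 0 < \<phi> x (mix a e y)" if "x \<in> Delta" "y \<in> Delta" "R x y" for x y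
    using eventually_mix(2)[OF that(1,2) aD that(3)] near[OF A(2) that(2)]
    by eventually_elim (use agree that in auto)
  have upper: "\<forall>\<^sub>F e in at_right 0. 0 < \<phi> (mix a e x) y" if "x \<in> Delta" "y \<in> Delta" "R x y" for x y
    using eventually_mix(1)[OF that(2,1) aD that(3)] near[OF A(2) that(1)]
    by eventually_elim (use agree that in auto)
  have nonneg: "0 \<le> \<phi> x y" if "x \<in> Delta" "y \<in> Delta" "R x y" for x y
    by (rule tendsto_lowerbound[OF lim[of x a y]]) (use lower[OF that] in \<open>auto elim: eventually_mono\<close>)
  have pos: "\<phi> x y > 0" if x: "x \<in> Delta" and y: "y \<in> Delta" and R: "R x y" for x y
  proof (rule ccontr)
    assume "\<not> \<phi> x y > 0"
    then have 0: "\<phi> x y = 0" using nonneg[OF that] by simp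
    define m where "m = mix x (1/2) y"
    have m: "m \<in> Delta" "R x m" "R m y"
      unfolding m_def using segment_iff[OF x y, of "1/2"] R x y by (auto intro: mix_in_Delta)
    have z: "\<phi> m y = 0" "\<phi> x m = 0" using 0 by (simp_all add: m_def lin lin' self)
    have "\<forall>\<^sub>F e in at_right 0. 0 < e \<and> 0 < e * \<phi> m a \<and> 0 < e * \<phi> a m"
      using lower[OF m(1) y m(3)] upper[OF x m(1,2)] eventually_at_right_01
      by eventually_elim (auto simp: lin lin' z)
    then obtain e :: real where "0 < e" "0 < e * \<phi> m a" "0 < e * \<phi> a m"
      using eventually_happens'[OF trivial_limit_at_right_real] by blast
    then show False using skew[of m a] by (simp add: zero_less_mult_iff)
  qed
  have "R p q" if pq: "\<phi> p q > 0"
  proof (rule ccontr)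
    assume "\<not> R p q"
    define m where "m = mix p (1/2) q"
    have m: "m \<in> Delta" unfolding m_def using p q by (auto intro: mix_in_Delta)
    have mq: "\<not> R m q"
      using \<open>\<not> R p q\<close> segment_iff[OF p q, of "1/2"] by (auto simp: m_def)
    have "\<phi> m q > 0" "\<phi> m p < 0" using pq skew[of q p] by (simp_all add: m_def lin' self)
    \<comment> \<open>Replace \<open>p\<close> by a nearby \<open>z\<close> in \<open>A\<close>,
      which is above \<open>m\<close>. Points near \<open>q\<close> towards \<open>z\<close> are
      then below \<open>m\<close>, although neither \<open>z\<close> nor \<open>q\<close>
      is.\<close>
    have "\<forall>\<^sub>F e in at_right 0. mix a e p \<in> A \<and> \<phi> m (mix a e p) < 0"
      using near[OF A(2) p] order_tendstoD(2)[OF lim \<open>\<phi> m p < 0\<close>, of a] by eventually_elim auto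
    then obtain z where z: "z \<in> A" "\<phi> m z < 0"
      using eventually_happens'[OF trivial_limit_at_right_real] by blast
    then have "R z m" using agree(1)[OF z(1) m] skew[of z m] by simp
    then have mz: "\<not> R m z" "z \<in> Delta" using asym m z A by auto
    have "\<forall>\<^sub>F e in at_right 0. R m (mix z e q) \<and> 0 < e \<and> e < 1"
      using near[OF z(1) q] order_tendstoD(1)[OF lim \<open>\<phi> m q > 0\<close>, of z] eventually_at_right_01
      by eventually_elim (use agree m in auto)
    then obtain e where "R m (mix z e q)" "0 < e" "e < 1"
      using eventually_happens'[OF trivial_limit_at_right_real] by blast
    then show False using mix_section(4)[OF m mz(2) q _ _ mz(1) mq, of e] by simp
  qed
  then show ?thesis using pos[OF p q] by blast
qed

lemma mix_Delta_pos:
  assumes "a \<in> Delta_pos" "p \<in> Delta" "0 < e" "e \<le> 1"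
  shows "mix a e p \<in> Delta_pos"
  using assms
  by (auto simp: Delta_pos_def Delta_def mix_def sum.distrib add_pos_nonneg simp flip: sum_distrib_left)

lemma ex_SSB_representation: "\<exists>\<phi>. SSB \<phi> \<and> represents \<phi> R"
proof (cases "\<exists>w\<in>Delta_pos. \<exists>y\<in>Delta. normal w \<bullet> y \<noteq> 0")
  case False
  \<comment> \<open>All normals vanish on \<open>Delta\<close>, so the zero form is right at
    interior points; the barycentre supplies the interior point that the extension needs.\<close>
  have pos: "(1 / real CARD('u)) *\<^sub>R 1 \<in> (Delta_pos :: (real^'u) set)"
    by (simp add: Delta_pos_def)
  have "\<not> R p q" if "p \<in> Delta" "q \<in> Delta" for p q
  proof -
    have "R p q \<longleftrightarrow> (0::real) > 0"
    proof (rule representation_extends[where A = Delta_pos and \<phi> = "\<lambda>_ _. 0", OF _ pos _ _ _ _ _ that])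
      fix a p :: "real^'u" assume "a \<in> Delta_pos" "p \<in> Delta"
      then show "\<forall>\<^sub>F e in at_right 0. mix a e p \<in> Delta_pos"
        using eventually_at_right_01 by (auto elim!: eventually_mono intro: mix_Delta_pos)
    qed (use False normal in \<open>auto simp: Delta_pos_subset\<close>)
    then show ?thesis by simp
  qed
  then show ?thesis by (intro exI[of _ "\<lambda>_ _. 0"]) (auto simp: SSB_def represents_def)
next
  case True
  then obtain w y where w: "w \<in> Delta_pos" and y: "y \<in> Delta" "normal w \<bullet> y \<noteq> 0" by auto
  \<comment> \<open>The interior points strictly ranked against \<open>w\<close>: there the scaling
    factor \<open>c\<close> below is positive.\<close>
  define A where "A = {x \<in> Delta_pos. normal w \<bullet> x \<noteq> 0}"
  define a where "a = mix w (1/2) y"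
  have a: "a \<in> A"
    using y normal(1)[OF w] by (auto simp: A_def a_def inner_mix intro!: mix_Delta_pos w)
  have AP: "x \<in> Delta_pos" if "x \<in> A" for x using that by (simp add: A_def)
  have near: "\<forall>\<^sub>F e in at_right 0. mix a e p \<in> A" if a: "a \<in> A" and p: "p \<in> Delta" for a p
  proof -
    have "\<forall>\<^sub>F e in at_right 0. normal w \<bullet> mix a e p \<noteq> 0"
    proof (cases "normal w \<bullet> p = 0")
      case True
      from eventually_at_right_01 show ?thesis
        by eventually_elim (use a True in \<open>simp add: inner_mix A_def\<close>)
    next
      case False
      then show ?thesis
        by (intro tendsto_imp_eventually_ne[OF tendsto_inner[OF tendsto_const tendsto_mix]])
    qed
    with eventually_at_right_01 show ?thesis
      by eventually_elim (use AP[OF a] p in \<open>auto simp: A_def intro: mix_Delta_pos\<close>)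
  qed
  \<comment> \<open>Each vertex is a combination of two points of \<open>A\<close>, so
    \<open>A\<close> spans the whole space.\<close>
  have "axis i 1 \<in> span A" for i
  proof -
    have "\<forall>\<^sub>F e in at_right 0. mix a e (axis i 1) \<in> A \<and> 0 < e \<and> e < 1"
      using near[OF a axis_in_Delta] eventually_at_right_01 by eventually_elim auto
    then obtain e where e: "mix a e (axis i 1) \<in> A" "0 < e" "e < 1"
      using eventually_happens'[OF trivial_limit_at_right_real] by blast
    have "axis i 1 = (1 / (1 - e)) *\<^sub>R (mix a e (axis i 1) - e *\<^sub>R a)"
      using e by (simp add: mix_def)
    also have "\<dots> \<in> span A" using e a by (intro span_scale span_diff span_base)
    finally show ?thesis .
  qed
  then have "Basis \<subseteq> span A" by (auto simp: Basis_vec_def)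
  then have spanA: "span A = UNIV" using span_Basis span_minimal[OF _ subspace_span] by blast
  obtain B where B: "B \<subseteq> A" "independent B" "A \<subseteq> span B"
    using maximal_independent_subset by blast
  then have spanB: "span B = UNIV" using spanA span_minimal[OF _ subspace_span] by blast
  \<comment> \<open>Chosen so that \<open>g x \<bullet> w = - (normal w \<bullet> x)\<close>,
    skew-symmetry against the reference point \<open>w\<close>.\<close>
  define c where "c x = - (normal w \<bullet> x) / (normal x \<bullet> w)" for x
  define g where "g x = c x *\<^sub>R normal x" for x
  have ne: "normal x \<bullet> w \<noteq> 0" "normal w \<bullet> x \<noteq> 0" if "x \<in> A" for x
    using that normal_swap(3)[OF w AP[OF that]] by (auto simp: A_def)
  have c: "c x > 0" if "x \<in> A" for x
    using ne[OF that] normal_swap(1,2)[OF w AP[OF that]] by (auto simp: c_def divide_less_0_iff linorder_neq_iff)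
  have g: "g x \<bullet> y = - (g y \<bullet> x)" if "x \<in> A" "y \<in> A" for x y
    using normal_cyclic[OF w AP[OF that(1)] AP[OF that(2)]] ne[OF that(1)] ne[OF that(2)]
    by (simp add: g_def c_def field_simps)
  obtain G where G: "linear G" "\<And>x. x \<in> B \<Longrightarrow> G x = g x"
    using linear_independent_extend[OF B(2)] by blast
  have linG: "linear (\<lambda>y. G y \<bullet> u)" for u
    using G(1) by (simp add: linear_iff inner_add_left)
  \<comment> \<open>For fixed \<open>u\<close> both sides are linear in \<open>y\<close>, and on the
    basis \<open>B\<close> they agree by the skew-symmetry of \<open>g\<close>.\<close>
  have GA: "G y \<bullet> u = - (g u \<bullet> y)" if u: "u \<in> A" for u y
  proof (rule linear_eq_on_span[where f = "\<lambda>y. G y \<bullet> u" and g = "\<lambda>y. - (g u \<bullet> y)" and B = B])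
    show "linear (\<lambda>y. - (g u \<bullet> y))" by (simp add: linear_iff inner_add_right)
    show "G x \<bullet> u = - (g u \<bullet> x)" if "x \<in> B" for x
      using that B u g[of x u] by (auto simp: G)
  qed (simp_all add: spanB linG)
  have skew: "G y \<bullet> x = - (G x \<bullet> y)" for x y
  proof (rule linear_eq_on_span[where f = "\<lambda>x. G y \<bullet> x" and g = "\<lambda>x. - (G x \<bullet> y)" and B = B])
    show "linear (\<lambda>x. G y \<bullet> x)" by (simp add: linear_iff inner_add_right)
    show "linear (\<lambda>x. - (G x \<bullet> y))" using linG[of y] by (simp add: linear_iff)
    show "G y \<bullet> x = - (G x \<bullet> y)" if "x \<in> B" for x
      using that B GA[of x y] by (auto simp: G)
  qed (simp_all add: spanB linG)
  \<comment> \<open>The arguments are swapped because a positive value of the normal at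
    \<open>y\<close> means being preferred to \<open>y\<close>.\<close>
  define \<phi> where "\<phi> x y = G y \<bullet> x" for x y
  have \<phi>: "\<phi> x y = - \<phi> y x" "\<phi> (mix p l q) x = l * \<phi> p x + (1 - l) * \<phi> q x" for x y p l q
    unfolding \<phi>_def by (rule skew) (rule inner_mix)
  have \<phi>': "\<phi> x (mix p l q) = l * \<phi> x p + (1 - l) * \<phi> x q" for x p l q
    using \<phi>(2)[of p l q x] \<phi>(1)[of x "mix p l q"] \<phi>(1)[of x p] \<phi>(1)[of x q] by (simp add: algebra_simps)
  have "R p q \<longleftrightarrow> \<phi> p q > 0" if pq: "p \<in> Delta" "q \<in> Delta" for p q
  proof (rule representation_extends[where A = A, OF _ a near \<phi>(1) \<phi>' _ _ pq])
    show "A \<subseteq> Delta" using AP Delta_pos_subset by blast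
    fix x y :: "real^'u" assume x: "x \<in> A" and y: "y \<in> Delta"
    have "\<phi> x y = - (c x * (normal x \<bullet> y))" "\<phi> y x = c x * (normal x \<bullet> y)"
      using GA[OF x, of y] skew[of x y] by (simp_all add: \<phi>_def g_def)
    then show "R x y \<longleftrightarrow> \<phi> x y > 0" "R y x \<longleftrightarrow> \<phi> y x > 0"
      using c[OF x] normal(2,3)[OF AP[OF x] y] by (simp_all add: zero_less_mult_iff mult_less_0_iff)
  qed
  then show ?thesis
    unfolding SSB_def represents_def by (intro exI[of _ \<phi>] conjI ballI allI impI \<phi> \<phi>')
qed

end

section \<open>From a representing function to the axioms\<close>

text \<open>Jensen's inequality for \<open>f\<close> and for \<open>- f\<close>, at the expansion of
  \<open>p\<close> into vertices, shows that the vertex values determine \<open>f\<close>.\<close>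

lemma affine_on_Delta:
  fixes f :: "real^'u::finite \<Rightarrow> real"
  assumes f: "\<And>p q l. p \<in> Delta \<Longrightarrow> q \<in> Delta \<Longrightarrow> 0 \<le> l \<Longrightarrow> l \<le> 1 \<Longrightarrow> f (mix p l q) = l * f p + (1 - l) * f q"
  obtains a where "\<And>p. p \<in> Delta \<Longrightarrow> f p = a \<bullet> p"
proof -
  have f': "f (u *\<^sub>R p + v *\<^sub>R q) = u * f p + v * f q"
    if "p \<in> Delta" "q \<in> Delta" "0 \<le> u" "0 \<le> v" "u + v = 1" for p q u v
  proof -
    have v: "v = 1 - u" using that by simp
    show ?thesis unfolding v using f[of p q u] that by (simp add: mix_def)
  qed
  have "convex_on Delta f" "convex_on Delta (\<lambda>x. - f x)"
    using f' convex_Delta by (auto simp: convex_on_def)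
  note convs = this
  have "f p = (\<chi> i. f (axis i 1)) \<bullet> p" if p: "p \<in> Delta" for p
  proof -
    have "p = (\<Sum>i\<in>UNIV. (p $ i) *\<^sub>R axis i 1)"
      using basis_expansion[of p] by (simp add: scalar_mult_eq_scaleR)
    moreover have "f (\<Sum>i\<in>UNIV. (p $ i) *\<^sub>R axis i 1) = (\<Sum>i\<in>UNIV. p $ i * f (axis i 1))"
    proof (rule antisym)
      show "f (\<Sum>i\<in>UNIV. (p $ i) *\<^sub>R axis i 1) \<le> (\<Sum>i\<in>UNIV. p $ i * f (axis i 1))"
        using p axis_in_Delta by (intro convex_on_sum[OF _ _ convs(1)]) (auto simp: Delta_def)
      have "- f (\<Sum>i\<in>UNIV. (p $ i) *\<^sub>R axis i 1) \<le> (\<Sum>i\<in>UNIV. p $ i * - f (axis i 1))"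
        using p axis_in_Delta by (intro convex_on_sum[OF _ _ convs(2)]) (auto simp: Delta_def)
      then show "f (\<Sum>i\<in>UNIV. (p $ i) *\<^sub>R axis i 1) \<ge> (\<Sum>i\<in>UNIV. p $ i * f (axis i 1))"
        by (simp add: sum_negf)
    qed
    ultimately show ?thesis by (simp add: inner_vec_def mult.commute)
  qed
  then show ?thesis by (rule that)
qed

text \<open>The sections at \<open>p\<close> are traces of half-spaces on \<open>Delta\<close>,
  which settles continuity and convexity; symmetry is a computation.\<close>

lemma SSB_imp_axioms:
  fixes R :: "real^'u::finite \<Rightarrow> real^'u \<Rightarrow> bool"
  assumes SSB: "SSB \<phi>" and rep: "represents \<phi> R"
  shows "pref_continuity R" "pref_convexity R" "pref_symmetry R"
proof -
  have skew: "\<phi> p q = - \<phi> q p" if "p \<in> Delta" "q \<in> Delta" for p q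
    using SSB that unfolding SSB_def by blast
  have lin: "\<phi> (mix p l q) r = l * \<phi> p r + (1 - l) * \<phi> q r" "\<phi> r (mix p l q) = l * \<phi> r p + (1 - l) * \<phi> r q"
    if "p \<in> Delta" "q \<in> Delta" "r \<in> Delta" "0 \<le> l" "l \<le> 1" for p q r l
    using SSB that unfolding SSB_def by blast+
  have R: "R p q \<longleftrightarrow> \<phi> p q > 0" "R q p \<longleftrightarrow> \<phi> p q < 0" "indiff R p q \<longleftrightarrow> \<phi> p q = 0"
    if "p \<in> Delta" "q \<in> Delta" for p q
    using rep that skew[OF that] by (auto simp: represents_def indiff_def)
  have sections: "\<exists>a. upper_set R p = Delta \<inter> {q. a \<bullet> q < 0} \<and> lower_set R p = Delta \<inter> {q. a \<bullet> q > 0}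
      \<and> upper_set R p \<union> indiff_set R p = Delta \<inter> {q. a \<bullet> q \<le> 0}
      \<and> lower_set R p \<union> indiff_set R p = Delta \<inter> {q. a \<bullet> q \<ge> 0}" if p: "p \<in> Delta" for p
  proof -
    obtain a where "\<And>q. q \<in> Delta \<Longrightarrow> \<phi> p q = a \<bullet> q"
      using affine_on_Delta[of "\<phi> p"] lin(2) p by metis
    then show ?thesis using R[OF p]
      by (intro exI[of _ a]) (auto simp: upper_set_def lower_set_def indiff_set_def)
  qed
  show "pref_continuity R"
    unfolding pref_continuity_def
  proof
    fix p :: "real^'u" assume "p \<in> Delta"
    from sections[OF this] show "openin (top_of_set Delta) (upper_set R p) \<and> openin (top_of_set Delta) (lower_set R p)"
      by (auto intro!: openin_open_Int open_halfspace_lt open_halfspace_gt)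
  qed
  show "pref_convexity R"
    unfolding pref_convexity_def
  proof
    fix p :: "real^'u" assume "p \<in> Delta"
    from sections[OF this] show "convex (upper_set R p) \<and> convex (lower_set R p) \<and>
        convex (upper_set R p \<union> indiff_set R p) \<and> convex (lower_set R p \<union> indiff_set R p)"
      by (elim exE conjE) (simp only:, intro conjI convex_Int convex_Delta convex_halfspace_lt convex_halfspace_gt
        convex_halfspace_le convex_halfspace_ge)
  qed
  show "pref_symmetry R"
    unfolding pref_symmetry_def
  proof (intro ballI allI impI)
    fix p q r :: "real^'u" and l :: real
    assume D: "p \<in> Delta" "q \<in> Delta" "r \<in> Delta" and l: "0 < l \<and> l < 1"
      and q: "indiff R q (mix p (1/2) r)" and m: "indiff R (mix p l r) (mix p (1/2) q)"
    have M: "mix x l y \<in> Delta" "mix x (1/2) y \<in> Delta" if "x \<in> Delta" "y \<in> Delta" for x y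
      using that l by (auto intro: mix_in_Delta)
    have self: "\<phi> p p = 0" "\<phi> r r = 0"
      using skew[OF D(1,1)] skew[OF D(3,3)] by linarith+
    have "\<phi> q (mix p (1/2) r) = 0"
      using q R(3)[OF D(2) M(2)[OF D(1,3)]] by simp
    then have "\<phi> q p + \<phi> q r = 0"
      using lin(2)[OF D(1,3,2), of "1/2"] by simp
    moreover have "\<phi> (mix p l r) (mix p (1/2) q) = 0"
      using m R(3)[OF M(1)[OF D(1,3)] M(2)[OF D(1,2)]] by simp
    then have "l * (\<phi> p p + \<phi> p q) + (1 - l) * (\<phi> r p + \<phi> r q) = 0"
      using lin(1)[OF D(1,3) M(2)[OF D(1,2)], of l] lin(2)[OF D(1,2,1), of "1/2"] lin(2)[OF D(1,2,3), of "1/2"] l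
      by (simp add: field_simps)
    \<comment> \<open>The first relation says \<open>\<phi> p q = - \<phi> r q\<close>, so
      exchanging \<open>p\<close> and \<open>r\<close> negates every term of the second.\<close>
    ultimately have "l * (\<phi> r r + \<phi> r q) + (1 - l) * (\<phi> p r + \<phi> p q) = 0"
      using self skew[OF D(1,2)] skew[OF D(3,2)] skew[OF D(1,3)] by (simp add: algebra_simps)
    then have "\<phi> (mix r l p) (mix r (1/2) q) = 0"
      using lin(1)[OF D(3,1) M(2)[OF D(3,2)], of l] lin(2)[OF D(3,2,3), of "1/2"] lin(2)[OF D(3,2,1), of "1/2"] l
      by (simp add: field_simps)
    then show "indiff R (mix r l p) (mix r (1/2) q)"
      using R(3)[OF M(1)[OF D(3,1)] M(2)[OF D(3,2)]] by simp
  qed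
qed

theorem proposition3:
  fixes R :: "real^'u::finite \<Rightarrow> real^'u \<Rightarrow> bool"
  assumes "preference_relation R"
  shows "(\<exists>\<phi>. SSB \<phi> \<and> represents \<phi> R) \<longleftrightarrow>
         pref_continuity R \<and> pref_convexity R \<and> pref_symmetry R"
proof
  assume "\<exists>\<phi>. SSB \<phi> \<and> represents \<phi> R"
  then show "pref_continuity R \<and> pref_convexity R \<and> pref_symmetry R"
    using SSB_imp_axioms by blast
next
  assume "pref_continuity R \<and> pref_convexity R \<and> pref_symmetry R"
  then interpret convex_preference R
    using assms by unfold_locales auto
  show "\<exists>\<phi>. SSB \<phi> \<and> represents \<phi> R" by (rule ex_SSB_representation)
qed

end
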